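(* Let $n\ge 5$ be an integer and let $\mathfrak S_{(n,4)}$ be the numerical semigroup generated by $m_0=n^2+2n$, $m_1=n^2+2n+1$, $m_2=n^2+3n+1$, $m_3=n^2+3n+2$. Then the Apéry table $\mathrm{AT}(\mathfrak S_{(n,4)},m_0)$ is an $(n+1)\times m_0$ matrix of the form $\begin{pmatrix}\mathcal A_0&\mathcal A_1&\mathcal A_2&\mathcal A_3&\mathcal A_4&\mathcal A_5\end{pmatrix}$ (for the ordering of the Apéry set given by the first row of this matrix), where, with row index $1\le i\le n+1$: $\bullet$ $\mathcal A_0=(a^{(0)}_{i1})_{(n+1)\times 1}$, $a^{(0)}_{i1}=(i-1)m_0$. $\bullet$ For $l=1,2$: $\mathcal A_l=(a^{(l)}_{ij})_{(n+1)\times n}$, $a^{(l)}_{ij}=jm_l+\gamma^{(l)}_{ij}m_0$, where $\gamma^{(l)}_{ij}=i-j-1$ if $i>j+1$ and $\gamma^{(l)}_{ij}=0$ if $i\le j+1$. $\bullet$ $\mathcal A_3=(a^{(3)}_{ij})_{(n+1)\times(n-1)}$, $a^{(3)}_{ij}=jm_3+\gamma^{(3)}_{ij}m_0$, where $\gamma^{(3)}_{ij}=i-j-1$ if $i>j+1$ and $\gamma^{(3)}_{ij}=0$ if $i\le j+1$. $\bullet$ $\mathcal A_4=\begin{pmatrix}\Omega_{14}&\cdots&\Omega_{(n-1)4}\end{pmatrix}$, where for $1\le r\le n-1$, $\Omega_{r4}=(\omega^{(r4)}_{ij})_{(n+1)\times(n-r)}$ with $\omega^{(r4)}_{ij}=rm_1+jm_3+\alpha^{(r4)}_{ij}m_0$,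 where $\alpha^{(r4)}_{ij}=i-j-1-r$ if $i-j-1-r>0$ and $\alpha^{(r4)}_{ij}=0$ if $i-j-1-r\le 0$. $\bullet$ $\mathcal A_5=\begin{pmatrix}\Omega_{15}&\cdots&\Omega_{(n-1)5}\end{pmatrix}$, where for $1\le r\le n-1$, $\Omega_{r5}=(\omega^{(r5)}_{ij})_{(n+1)\times(n-r)}$ with $\omega^{(r5)}_{ij}=rm_2+jm_3+\alpha^{(r5)}_{ij}m_0$, where $\alpha^{(r5)}_{ij}=i-j-1-r$ if $i-j-1-r>0$ and $\alpha^{(r5)}_{ij}=0$ if $i-j-1-r\le 0$.
   Context: For a numerical semigroup $\Gamma$ with multiplicity (least positive element) $a_1$, the Apéry set is $\mathrm{Ap}(\Gamma,a_1)=\{s\in\Gamma\mid s-a_1\notin\Gamma\}=\{\omega_0=0,\omega_1,\dots,\omega_{a_1-1}\}$. Let $M=\Gamma\setminus\{0\}$ and $sM=M+\dots+M$ ($s$ copies), and let the reduction number be $r=\min\{r\mid (r+1)M=a_1+rM\}$. Define $\omega_{0,i}=\omega_i$, $\omega_{1,0}=a_1$, $\omega_{1,i}=\omega_i$ for $1\le i\le a_1-1$, and inductively for $s\ge 1$: $\omega_{s+1,i}=\omega_{s,i}$ if $\omega_{s,i}\in (s+1)M$, and $\omega_{s+1,i}=\omega_{s,i}+a_1$ otherwise. The Apéry table $\mathrm{AT}(\Gamma,a_1)$ is the $(r+1)\times a_1$ table whose row number $s$ ($0\le s\le r$) is $(\omega_{s,0},\dots,\omega_{s,a_1-1})$. In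 the matrix notation of the claim, rows are indexed from $1$, so matrix row $i$ is row $s=i-1$ of the table. *)

theory Defs
  imports "Jordan_Normal_Form.Matrix" "HOL-Library.Set_Algebras"
begin

definition numerical_semigroup :: "nat set \<Rightarrow> bool" where
  "numerical_semigroup G \<longleftrightarrow>
     0 \<in> G \<and> (\<forall>x\<in>G. \<forall>y\<in>G. x + y \<in> G) \<and> finite (UNIV - G)"

inductive_set semigroup_generated :: "nat set \<Rightarrow> nat set" for A where
  zero: "0 \<in> semigroup_generated A"
| add: "a \<in> A \<Longrightarrow> s \<in> semigroup_generated A \<Longrightarrow> a + s \<in> semigroup_generated A"

definition multiplicity_of :: "nat set \<Rightarrow> nat" where
  "multiplicity_of G = (LEAST a. a \<in> G \<and> 0 < a)"

text \<open>The difference is taken in the integers, so that it does not truncate.\<close>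

definition apery_set :: "nat set \<Rightarrow> nat \<Rightarrow> nat set" where
  "apery_set G a = {s \<in> G. int s - int a \<notin> int ` G}"

text \<open>
  The \<open>s\<close>-fold sum \<open>M + \<dots> + M\<close> of \<open>M = G - {0}\<close>; \<open>+\<close> on sets is elementwise.
  As for powers of ideals, the \<open>0\<close>-fold sum is the whole semigroup \<open>G\<close>. This choice
  only affects the reduction number of \<open>G = UNIV\<close>.
\<close>

definition fold_sum :: "nat set \<Rightarrow> nat \<Rightarrow> nat set" where
  "fold_sum G s = (if s = 0 then G else (\<Sum>k<s. G - {0}))"

definition reduction_number :: "nat set \<Rightarrow> nat \<Rightarrow> nat" where
  "reduction_number G a = (LEAST r. fold_sum G (r + 1) = {a} + fold_sum G r)"

definition apery_enumeration :: "nat set \<Rightarrow> nat \<Rightarrow> (nat \<Rightarrow> nat) \<Rightarrow> bool" where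
  "apery_enumeration G a w \<longleftrightarrow> bij_betw w {0..<a} (apery_set G a) \<and> w 0 = 0"

fun apery_entry :: "nat set \<Rightarrow> nat \<Rightarrow> (nat \<Rightarrow> nat) \<Rightarrow> nat \<Rightarrow> nat \<Rightarrow> nat" where
  "apery_entry G a w 0 i = w i"
| "apery_entry G a w (Suc 0) i = (if i = 0 then a else w i)"
| "apery_entry G a w (Suc (Suc s)) i =
     (let v = apery_entry G a w (Suc s) i
      in if v \<in> fold_sum G (Suc (Suc s)) then v else v + a)"

text \<open>
  The table depends on the chosen enumeration \<open>w\<close> of the Apery set, which is its first row.
\<close>

definition apery_table :: "nat set \<Rightarrow> nat \<Rightarrow> (nat \<Rightarrow> nat) \<Rightarrow> nat mat" where
  "apery_table G a w = mat (reduction_number G a + 1) a (\<lambda>(s, i). apery_entry G a w s i)"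

definition append_cols :: "'a::zero mat \<Rightarrow> 'a mat \<Rightarrow> 'a mat" where
  "append_cols A B = four_block_mat A B (0\<^sub>m 0 (dim_col A)) (0\<^sub>m 0 (dim_col B))"

definition concat_cols :: "nat \<Rightarrow> 'a::zero mat list \<Rightarrow> 'a mat" where
  "concat_cols nr As = foldr append_cols As (0\<^sub>m nr 0)"

text \<open>A matrix whose entries are given by a formula in row and column indices starting at 1.\<close>

definition mat1 :: "nat \<Rightarrow> nat \<Rightarrow> (nat \<Rightarrow> nat \<Rightarrow> 'a) \<Rightarrow> 'a mat" where
  "mat1 nr nc f = mat nr nc (\<lambda>(i, j). f (i + 1) (j + 1))"

text \<open>In the blocks below, \<open>m 0, \<dots>, m 3\<close> are the generators of the semigroup.\<close>

definition gamma_coeff :: "nat \<Rightarrow> nat \<Rightarrow> nat" where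
  "gamma_coeff i j = (if i > j + 1 then i - j - 1 else 0)"

definition alpha_coeff :: "nat \<Rightarrow> nat \<Rightarrow> nat \<Rightarrow> nat" where
  "alpha_coeff r i j = (if int i - int j - 1 - int r > 0 then i - j - 1 - r else 0)"

definition block_A0 :: "(nat \<Rightarrow> nat) \<Rightarrow> nat \<Rightarrow> nat mat" where
  "block_A0 m n = mat1 (n + 1) 1 (\<lambda>i j. (i - 1) * m 0)"

definition block_A :: "(nat \<Rightarrow> nat) \<Rightarrow> nat \<Rightarrow> nat \<Rightarrow> nat \<Rightarrow> nat mat" where
  "block_A m n l nc = mat1 (n + 1) nc (\<lambda>i j. j * m l + gamma_coeff i j * m 0)"

definition block_Omega :: "(nat \<Rightarrow> nat) \<Rightarrow> nat \<Rightarrow> nat \<Rightarrow> nat \<Rightarrow> nat mat" where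
  "block_Omega m n l r =
     mat1 (n + 1) (n - r) (\<lambda>i j. r * m l + j * m 3 + alpha_coeff r i j * m 0)"

definition block_Omegas :: "(nat \<Rightarrow> nat) \<Rightarrow> nat \<Rightarrow> nat \<Rightarrow> nat mat" where
  "block_Omegas m n l = concat_cols (n + 1) (map (block_Omega m n l) [1..<n])"

definition claimed_table :: "(nat \<Rightarrow> nat) \<Rightarrow> nat \<Rightarrow> nat mat" where
  "claimed_table m n = concat_cols (n + 1)
     [block_A0 m n, block_A m n 1 n, block_A m n 2 n, block_A m n 3 (n - 1),
      block_Omegas m n 1, block_Omegas m n 2]"

end

theory Submission
  imports Defs
begin

text \<open>
  Write \<open>m\<^sub>0 = n\<^sup>2 + 2n = (n+1)\<^sup>2 - 1\<close>. The generators are \<open>m\<^sub>0 + p + q(n+1)\<close> with \<open>p, q \<in> {0, 1}\<close>,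
  so a sum of \<open>k\<close> of them is a number \<open>k m\<^sub>0 + p + q(n+1)\<close> with \<open>p, q \<le> k\<close>, and all choices of
  \<open>p, q \<le> k\<close> occur. Hence the \<open>s\<close>-fold sum \<open>sM\<close> consists of those numbers with \<open>k \<ge> s\<close>
  (\<open>fold_sum_eq_level_set\<close>), and every question becomes one about base \<open>n+1\<close> expansions
  modulo \<open>(n+1)\<^sup>2 - 1\<close>.

  The residues modulo \<open>m\<^sub>0\<close> are the two-digit numbers \<open>p + q(n+1)\<close>, \<open>p, q \<le> n\<close>, where only \<open>(n, n)\<close> is
  excluded because it stands for \<open>m\<^sub>0\<close> itself. The least element of the semigroup with digits
  \<open>(p, q)\<close> is \<open>max p q \<cdot> m\<^sub>0 + p + q(n+1)\<close>: these are the elements of the Apery set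
  (\<open>apery_set_eq\<close>). Since the digit part is smaller than \<open>m\<^sub>0\<close> and \<open>sM\<close> has no element below
  \<open>s m\<^sub>0\<close>, the column of \<open>(p, q)\<close> has the entry \<open>max s (max p q) \<cdot> m\<^sub>0 + p + q(n+1)\<close> in row \<open>s\<close>
  (\<open>apery_entry_eq\<close>). The reduction number is \<open>n\<close>: below \<open>n\<close> the Apery element \<open>(r+1) m\<^sub>1\<close> obstructs
  \<open>(r+1)M = m\<^sub>0 + rM\<close>, and from \<open>k = n+1\<close> on an expansion can be rewritten by carrying
  (\<open>level_set_Suc_n\<close>).

  It remains to see that the blocks list each digit pair once: \<open>j m\<^sub>1\<close>, \<open>j m\<^sub>2\<close>, \<open>j m\<^sub>3\<close>,
  \<open>r m\<^sub>1 + j m\<^sub>3\<close> and \<open>r m\<^sub>2 + j m\<^sub>3\<close> have the digit pairs \<open>(j, 0)\<close>, \<open>(0, j)\<close>, \<open>(j, j)\<close>, \<open>(r+j, j)\<close> and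
  \<open>(j, r+j)\<close>, so they run over the axes, the diagonal, and the two open triangles
  of the square \<open>[0, n]\<^sup>2\<close>.
\<close>

section \<open>The sums of the maximal ideal as level sets\<close>

definition expansion :: "nat \<Rightarrow> nat \<Rightarrow> nat \<Rightarrow> nat \<Rightarrow> nat" where
  "expansion n k p q = k * (n^2 + 2*n) + (p + q * (n + 1))"

definition level_set :: "nat \<Rightarrow> nat \<Rightarrow> nat set" where
  "level_set n s = {expansion n k p q | k p q. s \<le> k \<and> p \<le> k \<and> q \<le> k}"

lemma expansion_in_level_set:
  "s \<le> k \<Longrightarrow> p \<le> k \<Longrightarrow> q \<le> k \<Longrightarrow> expansion n k p q \<in> level_set n s"
  unfolding level_set_def by blast

lemma level_setE:
  assumes "x \<in> level_set n s"
  obtains k p q where "x = expansion n k p q" "s \<le> k" "p \<le> k" "q \<le> k"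
  using assms unfolding level_set_def by blast

lemma level_set_antimono: "s \<le> t \<Longrightarrow> level_set n t \<subseteq> level_set n s"
  unfolding level_set_def by fastforce

lemma expansion_add:
  "expansion n k p q + expansion n k' p' q' = expansion n (k + k') (p + p') (q + q')"
  unfolding expansion_def by (simp add: algebra_simps)

lemma level_set_lower_bound: "x \<in> level_set n s \<Longrightarrow> s * (n^2 + 2*n) \<le> x"
  by (elim level_setE) (simp add: expansion_def trans_le_add1)

lemma level_set_add_mem:
  "x \<in> level_set n s \<Longrightarrow> y \<in> level_set n t \<Longrightarrow> x + y \<in> level_set n (s + t)"
  by (elim level_setE) (simp add: expansion_add expansion_in_level_set add_mono)

text \<open>One unit can be split off the level together with at most one unit of each digit, which
  keeps both digits bounded by the remaining level.\<close>

lemma expansion_split: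
  assumes "p \<le> Suc k" "q \<le> Suc k"
  shows "expansion n (Suc k) p q =
    expansion n 1 (min p 1) (min q 1) + expansion n k (p - min p 1) (q - min q 1)"
  unfolding expansion_add by simp

lemma level_set_1_add: "level_set n 1 + level_set n s = level_set n (Suc s)"
proof (intro equalityI subsetI)
  fix x assume "x \<in> level_set n 1 + level_set n s"
  then show "x \<in> level_set n (Suc s)"
    using level_set_add_mem[of _ n 1 _ s] by (auto elim!: set_plus_elim)
next
  fix x assume "x \<in> level_set n (Suc s)"
  then obtain k p q where x: "x = expansion n k p q" "Suc s \<le> k" "p \<le> k" "q \<le> k"
    by (rule level_setE)
  then obtain l where k: "k = Suc l" by (cases k) auto
  show "x \<in> level_set n 1 + level_set n s"
    unfolding x(1) k expansion_split[OF x(3,4)[unfolded k]]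
    using x k by (intro set_plus_intro expansion_in_level_set) auto
qed

lemma semigroup_generated_eq_level_set:
  assumes "m (0::nat) = n^2 + 2*n" "m 1 = n^2 + 2*n + 1"
    and "m 2 = n^2 + 3*n + 1" "m 3 = n^2 + 3*n + 2"
  shows "semigroup_generated {m 0, m 1, m 2, m 3} = level_set n 0" (is "?G = _")
proof (intro equalityI subsetI)
  have gens: "m 0 = expansion n 1 0 0" "m 1 = expansion n 1 1 0"
    "m 2 = expansion n 1 0 1" "m 3 = expansion n 1 1 1"
    using assms by (simp_all add: expansion_def)
  {
    fix x assume "x \<in> ?G"
    then show "x \<in> level_set n 0"
    proof induction
      case zero
      show ?case using expansion_in_level_set[of 0 0 0 0 n] by (simp add: expansion_def)
    next
      case (add a x)
      have "a \<in> level_set n 0"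
        using add(1) unfolding gens
        by (elim insertE emptyE) (auto intro!: expansion_in_level_set)
      with add(3) show ?case using level_set_add_mem[of a n 0 x 0] by simp
    qed
  next
    fix x assume "x \<in> level_set n 0"
    then obtain k p q where "x = expansion n k p q" "p \<le> k" "q \<le> k"
      by (rule level_setE)
    moreover have "p \<le> k \<Longrightarrow> q \<le> k \<Longrightarrow> expansion n k p q \<in> ?G"
    proof (induction k arbitrary: p q)
      case 0
      then show ?case by (simp add: expansion_def semigroup_generated.zero)
    next
      case (Suc k)
      have "min p 1 = 0 \<or> min p 1 = 1" "min q 1 = 0 \<or> min q 1 = 1" by auto
      then have "expansion n 1 (min p 1) (min q 1) \<in> {m 0, m 1, m 2, m 3}"
        unfolding gens by (elim disjE) simp_all
      then show ?case
        unfolding expansion_split[OF Suc.prems]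
        by (rule semigroup_generated.add) (use Suc in auto)
    qed
    ultimately show "x \<in> ?G" by simp
  }
qed

lemma level_set_0_minus_zero:
  assumes "n \<ge> 1"
  shows "level_set n 0 - {0} = level_set n 1"
proof (intro equalityI subsetI)
  fix x assume "x \<in> level_set n 0 - {0}"
  then obtain k p q where x: "x = expansion n k p q" "p \<le> k" "q \<le> k" "x \<noteq> 0"
    by (auto elim: level_setE)
  then have "1 \<le> k" by (cases k) (auto simp: expansion_def)
  with x show "x \<in> level_set n 1" by (simp add: expansion_in_level_set)
next
  fix x assume x: "x \<in> level_set n 1"
  then have "x \<in> level_set n 0" using level_set_antimono[of 0 1 n] by auto
  moreover have "x \<noteq> 0" using level_set_lower_bound[OF x] assms by auto
  ultimately show "x \<in> level_set n 0 - {0}" by simp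
qed

lemma fold_sum_eq_level_set:
  assumes "n \<ge> 1"
  shows "fold_sum (level_set n 0) s = level_set n s"
proof -
  have "(\<Sum>k<Suc s. level_set n 1) = level_set n (Suc s)" for s
  proof (induction s)
    case (Suc s)
    have "(\<Sum>k<Suc (Suc s). level_set n 1) = level_set n 1 + (\<Sum>k<Suc s. level_set n 1)"
      by (simp only: sum.lessThan_Suc[of _ "Suc s"] add.commute)
    then show ?case by (simp only: Suc.IH level_set_1_add)
  qed simp
  then show ?thesis
    unfolding fold_sum_def level_set_0_minus_zero[OF assms] by (cases s) auto
qed

section \<open>Two-digit expansions and the Apery set\<close>

definition digit_pairs :: "nat \<Rightarrow> (nat \<times> nat) set" where
  "digit_pairs n = {0..n} \<times> {0..n} - {(n, n)}"

lemma card_digit_pairs: "card (digit_pairs n) = n^2 + 2*n"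
  unfolding digit_pairs_def by (simp add: card_Diff_singleton power2_eq_square)

lemma digit_pairs_less:
  assumes "(p, q) \<in> digit_pairs n"
  shows "p + q * (n + 1) < n^2 + 2*n"
proof -
  have pq: "p \<le> n" "q \<le> n" "p < n \<or> q < n"
    using assms by (auto simp: digit_pairs_def)
  show ?thesis
  proof (cases "q < n")
    case True
    then obtain d where "n = Suc (q + d)" using less_imp_Suc_add by blast
    then show ?thesis using pq by (simp add: power2_eq_square algebra_simps)
  next
    case False
    then show ?thesis using pq by (simp add: power2_eq_square algebra_simps)
  qed
qed

lemma digits_of_residue:
  assumes "x < n^2 + 2*n"
  shows "(x mod (n + 1), x div (n + 1)) \<in> digit_pairs n"
proof -
  have "x < (n + 1) * (n + 1)" using assms by (simp add: power2_eq_square)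
  then have "x div (n + 1) < n + 1" by (rule less_mult_imp_div_less)
  moreover have "x mod (n + 1) < n + 1" by simp
  moreover have "x = x div (n + 1) * (n + 1) + x mod (n + 1)" by (simp only: div_mult_mod_eq)
  then have "\<not> (x mod (n + 1) = n \<and> x div (n + 1) = n)"
    using assms by (auto simp: power2_eq_square algebra_simps)
  ultimately show ?thesis by (auto simp: digit_pairs_def)
qed

lemma digits_unique:
  assumes "p + q * (n + 1) = p' + q' * (n + 1)" "p \<le> n" "p' \<le> (n::nat)"
  shows "p = p' \<and> q = q'"
proof -
  have "(p + q * (n + 1)) mod (n + 1) = p" "(p + q * (n + 1)) div (n + 1) = q"
    "(p' + q' * (n + 1)) mod (n + 1) = p'" "(p' + q' * (n + 1)) div (n + 1) = q'"
    using assms(2,3) by (simp_all del: add_Suc_right mult_Suc_right)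
  then show ?thesis using assms(1) by metis
qed

lemma expansion_eq_digits:
  assumes "expansion n k p q = expansion n k' p' q'"
    and "(p, q) \<in> digit_pairs n" "(p', q') \<in> digit_pairs n"
  shows "k = k' \<and> p = p' \<and> q = q'"
proof -
  let ?M = "n^2 + 2*n"
  note less = digit_pairs_less[OF assms(2)] digit_pairs_less[OF assms(3)]
  have "(k * M + x) div M = k \<and> (k * M + x) mod M = x" if "x < M" for k x M :: nat
    using that by simp
  then have "expansion n k p q div ?M = k" "expansion n k p q mod ?M = p + q * (n + 1)"
    "expansion n k' p' q' div ?M = k'" "expansion n k' p' q' mod ?M = p' + q' * (n + 1)"
    using less unfolding expansion_def by blast+
  then have "k = k'" "p + q * (n + 1) = p' + q' * (n + 1)" using assms(1) by metis+
  moreover have "p \<le> n" "p' \<le> n" using assms by (auto simp: digit_pairs_def)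
  ultimately show ?thesis using digits_unique by metis
qed

text \<open>Removing \<open>m\<^sub>0\<close> from an expansion of minimal level leaves a level below \<open>max p q \<le> n\<close>. Any
  expansion of the result with digits bounded by its level would therefore have proper digits,
  and two-digit expansions are unique.\<close>

lemma below_minimal_level_not_in_semigroup:
  assumes "(p, q) \<in> digit_pairs n" "x \<in> level_set n 0"
  shows "expansion n (max p q) p q \<noteq> x + (n^2 + 2*n)"
proof
  assume eq: "expansion n (max p q) p q = x + (n^2 + 2*n)"
  obtain k p' q' where x: "x = expansion n k p' q'" "p' \<le> k" "q' \<le> k"
    using assms(2) by (rule level_setE)
  have eq': "expansion n (max p q) p q = expansion n (Suc k) p' q'"
    using eq x by (simp add: expansion_def)
  have "Suc k * (n^2 + 2*n) < Suc (max p q) * (n^2 + 2*n)"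
    using digit_pairs_less[OF assms(1)] eq' unfolding expansion_def mult_Suc by linarith
  then have "Suc k < Suc (max p q)" by (simp only: mult_less_cancel2)
  then have "Suc k \<le> max p q" by (rule less_Suc_eq_le[THEN iffD1])
  moreover have "p \<le> n" "q \<le> n" using assms(1) by (auto simp: digit_pairs_def)
  ultimately have "(p', q') \<in> digit_pairs n"
    using x by (auto simp: digit_pairs_def)
  from expansion_eq_digits[OF eq' assms(1) this] x(2,3) show False by auto
qed

lemma apery_set_iff: "s \<in> apery_set G a \<longleftrightarrow> s \<in> G \<and> (\<forall>g\<in>G. s \<noteq> g + a)"
proof -
  have "int s - int a \<in> int ` G \<longleftrightarrow> (\<exists>g\<in>G. s = g + a)"
    by (auto simp: image_iff algebra_simps simp flip: of_nat_add)
  then show ?thesis unfolding apery_set_def by blast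
qed

lemma expansion_of_residue:
  assumes "n \<ge> 1"
  obtains k p q where "x = expansion n k p q" "(p, q) \<in> digit_pairs n"
proof
  let ?M = "n^2 + 2*n"
  let ?r = "x mod ?M"
  have "?r mod (n + 1) + ?r div (n + 1) * (n + 1) = ?r" by (simp only: mod_div_mult_eq)
  then show "x = expansion n (x div ?M) (?r mod (n + 1)) (?r div (n + 1))"
    unfolding expansion_def by (simp only: div_mult_mod_eq)
  show "(?r mod (n + 1), ?r div (n + 1)) \<in> digit_pairs n"
    using assms by (intro digits_of_residue) simp
qed

lemma minimal_level_in_semigroup: "expansion n (max p q) p q \<in> level_set n 0"
  by (intro expansion_in_level_set) auto

lemma minimal_level_in_apery_set:
  assumes "(p, q) \<in> digit_pairs n"
  shows "expansion n (max p q) p q \<in> apery_set (level_set n 0) (n^2 + 2*n)"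
  using assms by (auto simp: apery_set_iff minimal_level_in_semigroup
      dest: below_minimal_level_not_in_semigroup)

lemma apery_set_eq:
  assumes "n \<ge> 1"
  shows "apery_set (level_set n 0) (n^2 + 2*n) =
    (\<lambda>(p, q). expansion n (max p q) p q) ` digit_pairs n"
proof (intro equalityI subsetI)
  let ?M = "n^2 + 2*n"
  have shift: "expansion n (k + e) p q = expansion n k p q + e * ?M" for k e p q
    by (simp add: expansion_def algebra_simps)
  have shift_mem: "x + e * ?M \<in> level_set n 0" if "x \<in> level_set n 0" for x e
    using level_set_add_mem[OF that expansion_in_level_set[of 0 e 0 0 n]]
    by (simp add: expansion_def)
  fix x assume "x \<in> apery_set (level_set n 0) ?M"
  then have x: "x \<in> level_set n 0" "\<And>g. g \<in> level_set n 0 \<Longrightarrow> x \<noteq> g + ?M"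
    by (auto simp: apery_set_iff)
  obtain k p q where xk: "x = expansion n k p q" and pq: "(p, q) \<in> digit_pairs n"
    using expansion_of_residue[OF assms] .
  let ?w = "expansion n (max p q) p q"
  have "k = max p q"
  proof (rule ccontr)
    assume "k \<noteq> max p q"
    then consider "max p q < k" | "k < max p q" by (rule linorder_neqE_nat)
    then show False
    proof cases
      case 1
      then obtain e where "k = max p q + Suc e" by (metis less_natE add_Suc_right)
      then have "x = (?w + e * ?M) + ?M" by (simp only: xk shift) simp
      then show False using x(2) shift_mem[OF minimal_level_in_semigroup] by metis
    next
      case 2
      then obtain e where "max p q = k + Suc e" by (metis less_natE add_Suc_right)
      then have "?w = (x + e * ?M) + ?M" by (simp only: xk shift) simp
      then show False
        using below_minimal_level_not_in_semigroup[OF pq] shift_mem[OF x(1)] by metis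
    qed
  qed
  then show "x \<in> (\<lambda>(p, q). expansion n (max p q) p q) ` digit_pairs n"
    using xk pq by force
qed (auto intro: minimal_level_in_apery_set)

section \<open>Numerical invariants of the semigroup\<close>

lemma numerical_semigroup_level_set:
  assumes "n \<ge> 1"
  shows "numerical_semigroup (level_set n 0)"
proof -
  let ?M = "n^2 + 2*n"
  \<comment> \<open>From \<open>n m\<^sub>0\<close> on the level is at least \<open>n\<close>, hence at least each digit.\<close>
  have "x \<in> level_set n 0" if "n * ?M \<le> x" for x
  proof -
    obtain k p q where x: "x = expansion n k p q" and pq: "(p, q) \<in> digit_pairs n"
      using expansion_of_residue[OF assms] .
    have "n * ?M < Suc k * ?M"
      using that digit_pairs_less[OF pq] unfolding x expansion_def mult_Suc by linarith
    then have "n < Suc k" by (simp only: mult_less_cancel2)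
    then show ?thesis
      using pq unfolding x by (intro expansion_in_level_set) (auto simp: digit_pairs_def)
  qed
  then have "UNIV - level_set n 0 \<subseteq> {..<n * ?M}"
    by (auto simp: not_le[symmetric])
  then have "finite (UNIV - level_set n 0)" by (rule finite_subset) simp
  moreover have "0 \<in> level_set n 0"
    using expansion_in_level_set[of 0 0 0 0 n] by (simp add: expansion_def)
  ultimately show ?thesis
    unfolding numerical_semigroup_def using level_set_add_mem[of _ n 0 _ 0] by simp
qed

lemma multiplicity_of_level_set:
  assumes "n \<ge> 1"
  shows "multiplicity_of (level_set n 0) = n^2 + 2*n"
  unfolding multiplicity_of_def
proof (rule Least_equality)
  show "n^2 + 2*n \<in> level_set n 0 \<and> 0 < n^2 + 2*n"
    using expansion_in_level_set[of 0 1 0 0 n] assms by (simp add: expansion_def)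
next
  fix a assume "a \<in> level_set n 0 \<and> 0 < a"
  then have "a \<in> level_set n 1" using level_set_0_minus_zero[OF assms] by auto
  then show "n^2 + 2*n \<le> a" using level_set_lower_bound by force
qed

text \<open>A carry \<open>(p, q) \<mapsto> (p - n - 1, q + 1)\<close> keeps the value, while \<open>(p, q) \<mapsto> (p - n, q - n)\<close> and
  \<open>(p, q) \<mapsto> (p + 1, q - n - 1)\<close> lower it by \<open>m\<^sub>0\<close>. At a level above \<open>n\<close> at least one of them
  applies whenever a digit equals the level. So \<open>m\<^sub>0\<close> can be removed, either from the digits at
  the same level or, when both digits allow it, by decreasing the level.\<close>

lemma expansion_lower_level:
  assumes "n < k" "p \<le> k" "q \<le> k"
  shows "\<exists>x \<in> level_set n n. expansion n k p q = (n^2 + 2*n) + x"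
proof -
  obtain l where k: "k = Suc l" "n \<le> l" using assms(1) by (cases k) auto
  consider "p \<le> l \<and> q \<le> l" | "n \<le> p \<and> n \<le> q" | "p = k \<and> q < n" | "q = k \<and> p < n"
    using assms k by linarith
  then show ?thesis
  proof cases
    case 1
    then show ?thesis
      using k by (intro bexI[of _ "expansion n l p q"] expansion_in_level_set)
        (auto simp: expansion_def)
  next
    case 2
    then obtain p' q' where "p = n + p'" "q = n + q'" using le_Suc_ex by metis
    then show ?thesis
      using assms by (intro bexI[of _ "expansion n k p' q'"] expansion_in_level_set)
        (auto simp: expansion_def power2_eq_square algebra_simps)
  next
    case 3
    then obtain p' where "p = n + 1 + p'" using assms le_Suc_ex[of "n+1" p] by auto
    then show ?thesis
      using 3 k by (intro bexI[of _ "expansion n l p' (q + 1)"] expansion_in_level_set)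
        (auto simp: expansion_def power2_eq_square algebra_simps)
  next
    case 4
    then obtain q' where "q = n + 1 + q'" using assms le_Suc_ex[of "n+1" q] by auto
    then show ?thesis
      using 4 k assms by (intro bexI[of _ "expansion n k (p + 1) q'"] expansion_in_level_set)
        (auto simp: expansion_def power2_eq_square algebra_simps)
  qed
qed

lemma level_set_Suc_n: "level_set n (Suc n) = {n^2 + 2*n} + level_set n n"
proof (intro equalityI subsetI)
  fix x assume "x \<in> level_set n (Suc n)"
  then show "x \<in> {n^2 + 2*n} + level_set n n"
    using expansion_lower_level[of n] by (fastforce elim: level_setE simp: set_plus_def)
next
  fix x assume "x \<in> {n^2 + 2*n} + level_set n n"
  moreover have "n^2 + 2*n \<in> level_set n 1"
    using expansion_in_level_set[of 1 1 0 0 n] by (simp add: expansion_def)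
  ultimately show "x \<in> level_set n (Suc n)"
    unfolding level_set_1_add[symmetric] by (auto simp: set_plus_def)
qed

lemma reduction_number_level_set:
  assumes "n \<ge> 1"
  shows "reduction_number (level_set n 0) (n^2 + 2*n) = n"
  unfolding reduction_number_def fold_sum_eq_level_set[OF assms]
proof (rule Least_equality)
  show "level_set n (n + 1) = {n^2 + 2*n} + level_set n n"
    using level_set_Suc_n by simp
next
  fix r assume r: "level_set n (r + 1) = {n^2 + 2*n} + level_set n r"
  show "n \<le> r"
  proof (rule ccontr)
    assume "\<not> n \<le> r"
    then have "(r + 1, 0) \<in> digit_pairs n" by (auto simp: digit_pairs_def)
    \<comment> \<open>The witness is \<open>(r+1) m\<^sub>1\<close>, an element of the Apery set and a sum of \<open>r+1\<close> generators.\<close>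
    then have "expansion n (r + 1) (r + 1) 0 \<noteq> x + (n^2 + 2*n)" if "x \<in> level_set n 0" for x
      using below_minimal_level_not_in_semigroup[OF _ that, of "r + 1" 0] by simp
    moreover have "expansion n (r + 1) (r + 1) 0 \<in> {n^2 + 2*n} + level_set n r"
      unfolding r[symmetric] by (intro expansion_in_level_set) auto
    ultimately show False
      using level_set_antimono[of 0 r n] by (auto simp: set_plus_def add.commute)
  qed
qed

section \<open>The rows of the Apery table\<close>

definition column_entry :: "nat \<Rightarrow> nat \<Rightarrow> nat \<times> nat \<Rightarrow> nat" where
  "column_entry n s d = expansion n (max s (max (fst d) (snd d))) (fst d) (snd d)"

text \<open>Since the digit part is below \<open>m\<^sub>0\<close>, an expansion with digits in range lies in \<open>sM\<close> only if
  its level is at least \<open>s\<close>. So an entry stays constant until the row number reaches the larger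
  digit, and then grows by \<open>m\<^sub>0\<close> from row to row.\<close>

lemma apery_entry_eq:
  assumes "n \<ge> 1" "w i = column_entry n 0 d" "d \<in> digit_pairs n" "i = 0 \<longleftrightarrow> d = (0, 0)"
  shows "apery_entry (level_set n 0) (n^2 + 2*n) w s i = column_entry n s d"
proof -
  let ?M = "n^2 + 2*n"
  obtain p q where d: "d = (p, q)" by force
  have less: "p + q * (n + 1) < ?M" using digit_pairs_less assms(3) d by blast
  have step: "(if column_entry n s d \<in> level_set n (Suc s) then column_entry n s d
      else column_entry n s d + ?M) = column_entry n (Suc s) d" for s
  proof (cases "s < max p q")
    case True
    then have "column_entry n s d \<in> level_set n (Suc s)"
      unfolding column_entry_def d by (intro expansion_in_level_set) auto
    moreover have "column_entry n s d = column_entry n (Suc s) d"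
      using True by (simp add: column_entry_def d max_def)
    ultimately show ?thesis by simp
  next
    case False
    then have c: "column_entry n s d = expansion n s p q"
      "column_entry n (Suc s) d = expansion n (Suc s) p q"
      by (simp_all add: column_entry_def d max_def)
    have "expansion n s p q < Suc s * ?M" using less by (simp add: expansion_def)
    then have "expansion n s p q \<notin> level_set n (Suc s)"
      using level_set_lower_bound not_le by blast
    then show ?thesis unfolding c by (simp add: expansion_def)
  qed
  show ?thesis
  proof (induction s)
    case 0
    show ?case using assms(2) by simp
  next
    case (Suc s)
    show ?case
    proof (cases s)
      case 0
      show ?thesis
      proof (cases "i = 0")
        case True
        then show ?thesis using assms(4) 0 by (simp add: column_entry_def expansion_def)
      next
        case False
        then have "0 < max p q" using assms(4) d by auto
        then have "column_entry n 0 d = column_entry n (Suc 0) d"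
          by (simp add: column_entry_def d max_def)
        then show ?thesis using False assms(2) 0 by simp
      qed
    next
      case (Suc t)
      then show ?thesis
        using Suc.IH step[of "Suc t"] by (simp add: fold_sum_eq_level_set[OF assms(1)] Let_def)
    qed
  qed
qed

section \<open>The columns of the claimed table\<close>

definition table_of :: "nat \<Rightarrow> (nat \<times> nat) list \<Rightarrow> nat mat" where
  "table_of n ds = mat (n + 1) (length ds) (\<lambda>(s, i). column_entry n s (ds ! i))"

lemma append_cols_table_of:
  "append_cols (table_of n ds) (table_of n es) = table_of n (ds @ es)"
  unfolding append_cols_def table_of_def
  by (rule eq_matI) (auto simp: nth_append)

lemma concat_cols_table_of:
  "concat_cols (n + 1) (map (table_of n) dss) = table_of n (concat dss)"
proof (induction dss)
  case Nil
  show ?case by (rule eq_matI) (auto simp: concat_cols_def table_of_def)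
next
  case (Cons ds dss)
  then show ?case by (simp add: concat_cols_def append_cols_table_of)
qed

definition column_digits :: "nat \<Rightarrow> (nat \<times> nat) list" where
  "column_digits n = concat
    [[(0, 0)], map (\<lambda>j. (j, 0)) [1..<n + 1], map (\<lambda>j. (0, j)) [1..<n + 1], map (\<lambda>j. (j, j)) [1..<n],
     concat (map (\<lambda>r. map (\<lambda>j. (r + j, j)) [1..<n - r + 1]) [1..<n]),
     concat (map (\<lambda>r. map (\<lambda>j. (j, r + j)) [1..<n - r + 1]) [1..<n])]"

text \<open>Passing from \<open>j\<close> generators in row \<open>j\<close> to row \<open>s \<ge> j\<close> adds the missing \<open>s - j\<close> copies of
  \<open>m\<^sub>0\<close>; the coefficients in the blocks are this truncated difference, shifted because
  matrix rows are counted from 1.\<close>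

lemma gamma_coeff_Suc: "gamma_coeff (Suc s) j = s - j"
  by (simp add: gamma_coeff_def)

lemma alpha_coeff_Suc: "alpha_coeff r (Suc s) j = s - (r + j)"
  by (auto simp: alpha_coeff_def)

lemma column_entry_eq:
  assumes "max p q = d"
  shows "column_entry n s (p, q) = expansion n d p q + (s - d) * (n^2 + 2*n)"
proof -
  have "max s d = d + (s - d)" by simp
  then show ?thesis
    using assms by (simp add: column_entry_def expansion_def add_mult_distrib del: max.bounded_iff)
qed

lemma table_of_map_eq_mat1:
  assumes "\<And>s j. j \<ge> 1 \<Longrightarrow> column_entry n s (f j) = g (Suc s) j"
  shows "mat1 (n + 1) c g = table_of n (map f [1..<c + 1])"
  unfolding mat1_def table_of_def using assms
  by (intro eq_matI) (auto simp del: upt_Suc)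

lemma claimed_table_eq:
  assumes "n \<ge> 1" "m 0 = n^2 + 2*n" "m 1 = n^2 + 2*n + 1"
    and "m 2 = n^2 + 3*n + 1" "m 3 = n^2 + 3*n + 2"
  shows "claimed_table m n = table_of n (column_digits n)"
proof -
  have A0: "block_A0 m n = table_of n [(0, 0)]"
    using assms unfolding block_A0_def
    by (subst table_of_map_eq_mat1[where f = "\<lambda>_. (0, 0)"])
      (simp_all add: column_entry_eq[OF refl] expansion_def)
  have A1: "block_A m n 1 n = table_of n (map (\<lambda>j. (j, 0)) [1..<n + 1])"
    unfolding block_A_def using assms
    by (intro table_of_map_eq_mat1)
      (simp add: column_entry_eq[OF refl] expansion_def gamma_coeff_Suc algebra_simps)
  have A2: "block_A m n 2 n = table_of n (map (\<lambda>j. (0, j)) [1..<n + 1])"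
    unfolding block_A_def using assms
    by (intro table_of_map_eq_mat1)
      (simp add: column_entry_eq[OF refl] expansion_def gamma_coeff_Suc algebra_simps)
  have A3: "block_A m n 3 (n - 1) = table_of n (map (\<lambda>j. (j, j)) [1..<n - 1 + 1])"
    unfolding block_A_def using assms
    by (intro table_of_map_eq_mat1)
      (simp add: column_entry_eq[OF refl] expansion_def gamma_coeff_Suc algebra_simps)
  have O1: "block_Omega m n 1 r = table_of n (map (\<lambda>j. (r + j, j)) [1..<n - r + 1])" for r
    unfolding block_Omega_def using assms
    by (intro table_of_map_eq_mat1)
      (simp add: column_entry_eq[of _ _ "r + _"] expansion_def alpha_coeff_Suc algebra_simps)
  have O2: "block_Omega m n 2 r = table_of n (map (\<lambda>j. (j, r + j)) [1..<n - r + 1])" for r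
    unfolding block_Omega_def using assms
    by (intro table_of_map_eq_mat1)
      (simp add: column_entry_eq[of _ _ "r + _"] expansion_def alpha_coeff_Suc algebra_simps)
  have Omegas: "block_Omegas m n l = table_of n (concat (map f [1..<n]))"
    if "\<And>r. block_Omega m n l r = table_of n (f r)" for l f
  proof -
    have "block_Omega m n l = table_of n \<circ> f" using that by auto
    then show ?thesis
      unfolding block_Omegas_def concat_cols_table_of[symmetric] by simp
  qed
  have n: "n - 1 + 1 = n" using assms(1) by simp
  show ?thesis
    unfolding claimed_table_def column_digits_def concat_cols_table_of[symmetric]
    by (simp only: A0 A1 A2 A3 n Omegas[OF O1] Omegas[OF O2] list.map)
qed

lemma set_column_digits:
  assumes "n \<ge> 1"
  shows "set (column_digits n) = digit_pairs n"
proof (intro equalityI subsetI)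
  fix d assume "d \<in> set (column_digits n)"
  then show "d \<in> digit_pairs n"
    using assms by (auto simp: column_digits_def digit_pairs_def simp del: upt_Suc)
next
  have triangle: "f r j \<in> set (concat (map (\<lambda>r. map (f r) [1..<n - r + 1]) [1..<n]))"
    if "r \<in> {1..<n}" "j \<in> {1..<n - r + 1}" for f :: "nat \<Rightarrow> nat \<Rightarrow> nat \<times> nat" and r j
    unfolding set_concat
  proof (rule UN_I)
    show "map (f r) [1..<n - r + 1] \<in> set (map (\<lambda>r. map (f r) [1..<n - r + 1]) [1..<n])"
      unfolding set_map set_upt using that(1) by (rule imageI)
    show "f r j \<in> set (map (f r) [1..<n - r + 1])"
      unfolding set_map set_upt using that(2) by (rule imageI)
  qed
  fix d assume "d \<in> digit_pairs n"
  then obtain p q where d: "d = (p, q)" "p \<le> n" "q \<le> n" "\<not> (p = n \<and> q = n)"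
    by (cases d) (auto simp: digit_pairs_def)
  consider "q = 0" | "p = 0" | "p = q" "0 < q" | "0 < q" "q < p" | "0 < p" "p < q"
    by linarith
  then show "d \<in> set (column_digits n)"
  proof cases
    case 4
    then have "d = (p - q + q, q)" "p - q \<in> {1..<n}" "q \<in> {1..<n - (p - q) + 1}"
      using d by auto
    then show ?thesis
      using triangle[of "p - q" q "\<lambda>r j. (r + j, j)"]
      unfolding column_digits_def concat.simps set_append by blast
  next
    case 5
    then have "d = (p, q - p + p)" "q - p \<in> {1..<n}" "p \<in> {1..<n - (q - p) + 1}"
      using d by auto
    then show ?thesis
      using triangle[of "q - p" p "\<lambda>r j. (j, r + j)"]
      unfolding column_digits_def concat.simps set_append by blast
  qed (use d in \<open>auto simp: column_digits_def simp del: upt_Suc\<close>)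
qed

lemma length_column_digits:
  assumes "n \<ge> 1"
  shows "length (column_digits n) = n^2 + 2*n"
proof -
  have gauss: "2 * (\<Sum>r\<leftarrow>[1..<n]. n - r) = n * (n - 1)"
  proof -
    have "(\<Sum>r\<leftarrow>[1..<n]. n - r) = (\<Sum>r = 1..<n. n - r)"
      by (simp add: interv_sum_list_conv_sum_set_nat)
    also have "\<dots> = (\<Sum>r = 1..<n. r)"
      by (rule sum.reindex_bij_witness[of _ "\<lambda>r. n - r" "\<lambda>r. n - r"]) auto
    also have "2 * \<dots> = n * (n - 1)"
      using assms by (induction n rule: dec_induct) (auto simp: algebra_simps)
    finally show ?thesis .
  qed
  obtain k where k: "n = Suc k" using assms by (cases n) auto
  have "length (column_digits n) = 3 * n + 2 * (\<Sum>r\<leftarrow>[1..<n]. n - r)"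
    using assms by (simp add: column_digits_def length_concat comp_def del: upt_Suc)
  then show ?thesis unfolding gauss by (simp add: k power2_eq_square)
qed

text \<open>The list covers the digit pairs and is as long as their number.\<close>

lemma distinct_column_digits: "n \<ge> 1 \<Longrightarrow> distinct (column_digits n)"
  by (rule card_distinct) (simp add: set_column_digits length_column_digits card_digit_pairs)

lemma column_digits_nth_0: "column_digits n ! 0 = (0, 0)"
  by (simp add: column_digits_def)

theorem theorem5p4:
  fixes n :: nat and m :: "nat \<Rightarrow> nat" and G :: "nat set"
  assumes "n \<ge> 5"
    and "m 0 = n^2 + 2*n"
    and "m 1 = n^2 + 2*n + 1"
    and "m 2 = n^2 + 3*n + 1"
    and "m 3 = n^2 + 3*n + 2"
    and "G = semigroup_generated {m 0, m 1, m 2, m 3}"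
  shows "numerical_semigroup G \<and> multiplicity_of G = m 0 \<and>
    claimed_table m n \<in> carrier_mat (n + 1) (m 0) \<and>
    apery_enumeration G (m 0) (\<lambda>i. claimed_table m n $$ (0, i)) \<and>
    apery_table G (m 0) (\<lambda>i. claimed_table m n $$ (0, i)) = claimed_table m n"
proof -
  let ?ds = "column_digits n"
  let ?w = "\<lambda>i. claimed_table m n $$ (0, i)"
  have n: "n \<ge> 1" using assms(1) by simp
  have G: "G = level_set n 0"
    using assms(2-6) semigroup_generated_eq_level_set by metis
  have T: "claimed_table m n = table_of n ?ds"
    using claimed_table_eq[of n m, OF n] assms(2-5) by simp
  have len: "length ?ds = m 0" using length_column_digits[OF n] assms(2) by simp
  have w: "?w i = column_entry n 0 (?ds ! i)" if "i < m 0" for i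
    using that by (simp add: T table_of_def len)
  have zero: "i = 0 \<longleftrightarrow> ?ds ! i = (0, 0)" if "i < m 0" for i
    using that nth_eq_iff_index_eq[OF distinct_column_digits[OF n], of i 0]
    by (auto simp: len column_digits_nth_0)
  have mem: "?ds ! i \<in> digit_pairs n" if "i < m 0" for i
    using that nth_mem[of i ?ds] set_column_digits[OF n] len by auto
  have "bij_betw (\<lambda>i. ?ds ! i) {0..<m 0} (digit_pairs n)"
    using bij_betw_nth[OF distinct_column_digits[OF n]] len set_column_digits[OF n]
    by (simp add: atLeast0LessThan)
  moreover have "bij_betw (column_entry n 0) (digit_pairs n) (apery_set G (m 0))"
    unfolding bij_betw_def
  proof
    show "inj_on (column_entry n 0) (digit_pairs n)"
      by (auto simp: inj_on_def column_entry_def dest: expansion_eq_digits)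
    show "column_entry n 0 ` digit_pairs n = apery_set G (m 0)"
      unfolding G assms(2) apery_set_eq[OF n]
      by (intro image_cong) (auto simp: column_entry_def)
  qed
  ultimately have "bij_betw (column_entry n 0 \<circ> (\<lambda>i. ?ds ! i)) {0..<m 0} (apery_set G (m 0))"
    by (rule bij_betw_trans)
  then have "bij_betw ?w {0..<m 0} (apery_set G (m 0))"
    by (subst bij_betw_cong[where g = "column_entry n 0 \<circ> (\<lambda>i. ?ds ! i)"]) (auto simp: w)
  moreover have "?w 0 = 0"
    using w[of 0] n assms(2)
    by (simp add: column_digits_nth_0 column_entry_def expansion_def)
  ultimately have enum: "apery_enumeration G (m 0) ?w"
    by (simp add: apery_enumeration_def)
  have "apery_entry G (m 0) ?w s i = column_entry n s (?ds ! i)" if "i < m 0" for s i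
    unfolding G assms(2)
    by (rule apery_entry_eq[where w = ?w, OF n w[OF that] mem[OF that] zero[OF that]])
  moreover have "reduction_number G (m 0) = n"
    unfolding G assms(2) by (rule reduction_number_level_set[OF n])
  ultimately have "apery_table G (m 0) ?w = claimed_table m n"
    unfolding apery_table_def by (subst (2) T) (auto simp: table_of_def len intro!: eq_matI)
  moreover have "claimed_table m n \<in> carrier_mat (n + 1) (m 0)"
    unfolding T table_of_def len by simp
  ultimately show ?thesis
    using enum numerical_semigroup_level_set[OF n] multiplicity_of_level_set[OF n]
    unfolding G assms(2) by simp
qed

end
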